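(* Let $\phi$ be a self-map of $\mathbb{H}$ of parabolic zero-step type. Let $z_0,\tilde z_0\in\mathbb{H}$, and let $h$ and $\tilde h$ be the Baker–Pommerenke semiconjugations of $\phi$ based at $z_0$ and $\tilde z_0$ respectively. Then $\tilde h(z)=h(z)-h(\tilde z_0)$ for all $z\in\mathbb{H}$.
   Context: $\mathbb{H}=\{z\in\mathbb{C}:\operatorname{Im}z>0\}$, $\rho_{\mathbb{H}}$ is the hyperbolic distance, $\phi_n$ is the $n$-th iterate of $\phi$. n.t.-lim as $z\to\infty$ means the limit as $z\to\infty$ inside each sector $\{|\operatorname{Arg}z-\pi/2|<\theta\}$, $0<\theta<\pi/2$. A self-map of $\mathbb{H}$ of parabolic zero-step type is an analytic map $\phi:\mathbb{H}\to\mathbb{H}$, not an automorphism, of the form $\phi(z)=z+p(z)$ with $\operatorname{Im}p>0$ on $\mathbb{H}$ and n.t.-$\lim_{z\to\infty}p(z)/z=0$, such that $\rho_{\mathbb{H}}(\phi_n(z),\phi_{n+1}(z))\to0$ for one (equivalently, every) $z\in\mathbb{H}$. Baker–Pommerenke semiconjugation based at $z_0$: let $z_n=\phi_n(z_0)$ and $\mu_n(z)=\frac{z-z_n}{z_{n+1}-z_n}$. By a theorem of Baker and Pommerenke, $h=\lim_{n}\mu_n\circ\phi_n$ exists locally uniformly in $\mathbb{H}$, $h(z_0)=0$, and $h\circ\phi=h+1$. *)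

theory Defs
  imports "HOL-Analysis.Analysis"
begin

definition upper_half_plane :: "complex set" where
  "upper_half_plane = {z. Im z > 0}"

text \<open>Closed form of the distance of the metric \<open>|dz| / Im z\<close> (curvature \<open>-1\<close>);
  meaningful only for \<open>z\<close> and \<open>w\<close> in the upper half-plane.\<close>
definition hyp_dist :: "complex \<Rightarrow> complex \<Rightarrow> real" where
  "hyp_dist z w = 2 * artanh (norm (z - w) / norm (z - cnj w))"

definition sector :: "real \<Rightarrow> complex set" where
  "sector \<theta> = {z. z \<noteq> 0 \<and> \<bar>Arg z - pi / 2\<bar> < \<theta>}"

text \<open>Nontangential limit at infinity in the upper half-plane. For \<open>\<theta> < pi / 2\<close> the sectors lie in
  the upper half-plane, so values of \<open>f\<close> elsewhere are irrelevant.\<close>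
definition has_nt_lim_at_infinity :: "(complex \<Rightarrow> complex) \<Rightarrow> complex \<Rightarrow> bool" where
  "has_nt_lim_at_infinity f l \<longleftrightarrow>
     (\<forall>\<theta>. 0 < \<theta> \<and> \<theta> < pi / 2 \<longrightarrow> (f \<longlongrightarrow> l) (inf at_infinity (principal (sector \<theta>))))"

definition half_plane_automorphism :: "(complex \<Rightarrow> complex) \<Rightarrow> bool" where
  "half_plane_automorphism \<phi> \<longleftrightarrow>
     \<phi> holomorphic_on upper_half_plane \<and> \<phi> ` upper_half_plane \<subseteq> upper_half_plane \<and>
     (\<exists>\<psi>. \<psi> holomorphic_on upper_half_plane \<and> \<psi> ` upper_half_plane \<subseteq> upper_half_plane \<and>
          (\<forall>z\<in>upper_half_plane. \<psi> (\<phi> z) = z \<and> \<phi> (\<psi> z) = z))"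

text \<open>The zero-step condition is required at one point only; it then holds at every point.\<close>
definition parabolic_zero_step :: "(complex \<Rightarrow> complex) \<Rightarrow> bool" where
  "parabolic_zero_step \<phi> \<longleftrightarrow>
     \<phi> holomorphic_on upper_half_plane \<and> \<phi> ` upper_half_plane \<subseteq> upper_half_plane \<and>
     \<not> half_plane_automorphism \<phi> \<and>
     (\<exists>p. (\<forall>z\<in>upper_half_plane. \<phi> z = z + p z \<and> Im (p z) > 0) \<and>
          has_nt_lim_at_infinity (\<lambda>z. p z / z) 0) \<and>
     (\<exists>z\<in>upper_half_plane. (\<lambda>n. hyp_dist ((\<phi> ^^ n) z) ((\<phi> ^^ Suc n) z)) \<longlonglongrightarrow> 0)"

text \<open>The affine map sending \<open>z\<^sub>n\<close> to \<open>0\<close> and \<open>z\<^sub>n\<^sub>+\<^sub>1\<close> to \<open>1\<close>, where \<open>z\<^sub>n\<close> is the \<open>n\<close>-th iterate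
  of \<open>z0\<close>.\<close>
definition bp_affine :: "(complex \<Rightarrow> complex) \<Rightarrow> complex \<Rightarrow> nat \<Rightarrow> complex \<Rightarrow> complex" where
  "bp_affine \<phi> z0 n z = (z - (\<phi> ^^ n) z0) / ((\<phi> ^^ Suc n) z0 - (\<phi> ^^ n) z0)"

text \<open>\<open>h\<close> is the locally uniform limit defining the Baker--Pommerenke semiconjugation. Only the
  limit is part of the definition: \<open>h z0 = 0\<close> and \<open>h \<circ> \<phi> = h + 1\<close> are consequences. The values
  of \<open>h\<close> are determined on the upper half-plane only.\<close>
definition is_baker_pommerenke ::
  "(complex \<Rightarrow> complex) \<Rightarrow> complex \<Rightarrow> (complex \<Rightarrow> complex) \<Rightarrow> bool" where
  "is_baker_pommerenke \<phi> z0 h \<longleftrightarrow>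
     (\<forall>K. compact K \<and> K \<subseteq> upper_half_plane \<longrightarrow>
        uniform_limit K (\<lambda>n. bp_affine \<phi> z0 n \<circ> (\<phi> ^^ n)) h sequentially)"

end

theory Submission
  imports Defs "HOL-Complex_Analysis.Complex_Analysis"
begin

text \<open>The displacement \<open>P z = \<phi> z - z\<close> maps the half-plane into itself, so by Schwarz--Pick the
  hyperbolic distance of \<open>P z\<^sub>n\<close> and \<open>P z\<^sub>n\<^sub>+\<^sub>1\<close> is at most that of \<open>z\<^sub>n\<close> and \<open>z\<^sub>n\<^sub>+\<^sub>1\<close>, which tends to
  \<open>0\<close>. Hence consecutive normalising factors \<open>P z\<^sub>n = z\<^sub>n\<^sub>+\<^sub>1 - z\<^sub>n\<close> have quotient tending to \<open>1\<close>, so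
  \<open>h \<circ> \<phi> = h + 1\<close>. Thus the quotient of the normalising factors of \<open>h'\<close> and \<open>h\<close> tends to
  \<open>h (\<phi> z0') - h z0' = 1\<close>, and the claim follows by dividing limits.\<close>

section \<open>Pseudo-hyperbolic distance and the Schwarz--Pick lemma\<close>

text \<open>The modulus at \<open>z\<close> of the Cayley map that sends \<open>w\<close> to 0.
  Being algebraic, it replaces the hyperbolic distance in all estimates.\<close>

definition pseudo_dist :: "complex \<Rightarrow> complex \<Rightarrow> real" where
  "pseudo_dist z w = norm (z - w) / norm (z - cnj w)"

lemma norm_diff_less_norm_diff_cnj:
  assumes "Im z > 0" "Im w > 0"
  shows "norm (z - w) < norm (z - cnj w)"
proof -
  have "(Im z - Im w)\<^sup>2 < (Im z + Im w)\<^sup>2"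
    using assms by (simp add: power2_eq_square algebra_simps)
  then show ?thesis by (simp add: cmod_def)
qed

lemma pseudo_dist_bounds:
  assumes "Im z > 0" "Im w > 0"
  shows "0 \<le> pseudo_dist z w" "pseudo_dist z w < 1"
proof -
  have "norm (z - w) < norm (z - cnj w)"
    by (rule norm_diff_less_norm_diff_cnj[OF assms])
  moreover have "0 \<le> norm (z - w)" by simp
  ultimately have "0 < norm (z - cnj w)" by linarith
  with \<open>norm (z - w) < norm (z - cnj w)\<close>
  show "0 \<le> pseudo_dist z w" "pseudo_dist z w < 1"
    by (auto simp: pseudo_dist_def)
qed

text \<open>Through continuity of tanh, this turns the zero-step hypothesis into convergence of
  \<open>pseudo_dist\<close> to 0.\<close>

lemma tanh_half_hyp_dist:
  assumes "Im z > 0" "Im w > 0"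
  shows "tanh (hyp_dist z w / 2) = pseudo_dist z w"
proof -
  define x where "x = pseudo_dist z w"
  have x: "0 \<le> x" "x < 1"
    using pseudo_dist_bounds[OF assms] by (auto simp: x_def)
  have "exp (- 2 * artanh x) = (1 - x) / (1 + x)"
    using x by (simp add: artanh_def exp_minus)
  then have "tanh (artanh x) = (1 - (1 - x) / (1 + x)) / (1 + (1 - x) / (1 + x))"
    by (simp only: tanh_real_altdef)
  also have "\<dots> = x" using x by (simp add: field_simps)
  finally have "tanh (artanh x) = x" .
  then show ?thesis by (simp add: hyp_dist_def x_def pseudo_dist_def)
qed

text \<open>Conjugation by Cayley maps reduces this to the Schwarz lemma: \<open>B\<close> maps the
  disc to the half-plane with \<open>B 0 = b\<close>, and \<open>G\<close> follows \<open>F\<close>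
  by the map back that sends \<open>F b\<close> to 0.\<close>

lemma schwarz_pick:
  assumes hol: "F holomorphic_on upper_half_plane"
    and maps: "\<And>z. Im z > 0 \<Longrightarrow> Im (F z) > 0"
    and a: "Im a > 0" and b: "Im b > 0"
  shows "pseudo_dist (F a) (F b) \<le> pseudo_dist a b"
proof -
  define B where "B = (\<lambda>u. (b - cnj b * u) / (1 - u))"
  define G where "G = (\<lambda>u. (F (B u) - F b) / (F (B u) - cnj (F b)))"
  have ne1: "1 - u \<noteq> 0" if "u \<in> ball 0 1" for u :: complex
    using that by auto
  have ImB: "Im (B u) > 0" if u: "u \<in> ball 0 1" for u
  proof -
    \<comment> \<open>A quotient has imaginary part of the same sign as numerator times conjugate
      denominator.\<close>
    have "Im ((b - cnj b * u) * cnj (1 - u)) = Im b * (1 - (norm u)\<^sup>2)"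
      unfolding cmod_power2 by (simp add: power2_eq_square algebra_simps)
    moreover have "(norm u)\<^sup>2 < 1" using u by (simp add: power_less_one_iff)
    ultimately have "Im ((b - cnj b * u) * cnj (1 - u)) > 0" using b by simp
    then show ?thesis
      by (simp only: B_def Im_complex_div_gt_0)
  qed
  have ne2: "z - cnj w \<noteq> 0" if "Im z > 0" "Im w > 0" for z w
    using that by (auto simp: complex_eq_iff)
  have "B holomorphic_on ball 0 1"
    unfolding B_def using ne1 by (intro holomorphic_intros) auto
  then have "(F \<circ> B) holomorphic_on ball 0 1"
    by (rule holomorphic_on_compose_gen[OF _ hol]) (auto simp: upper_half_plane_def intro!: ImB)
  then have "G holomorphic_on ball 0 1"
    unfolding G_def using ne2[OF maps[OF ImB] maps[OF b]]
    by (intro holomorphic_intros) (auto simp: o_def)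
  moreover have "G 0 = 0" by (simp add: G_def B_def)
  moreover have "norm (G u) < 1" if "norm u < 1" for u
    using pseudo_dist_bounds[OF maps[OF ImB] maps[OF b], of u] that
    by (simp add: G_def pseudo_dist_def norm_divide)
  ultimately have G: "norm (G u) \<le> norm u" if "norm u < 1" for u
    using Schwarz_Lemma(1)[of G u] that by blast
  \<comment> \<open>The preimage of \<open>a\<close> under \<open>B\<close>.\<close>
  define u where "u = (a - b) / (a - cnj b)"
  have u: "norm u = pseudo_dist a b" "norm u < 1"
    using pseudo_dist_bounds[OF a b] by (simp_all add: u_def pseudo_dist_def norm_divide)
  have "b - cnj b * u = a * (1 - u)"
    using ne2[OF a b] by (simp add: u_def field_simps)
  then have "B u = a"
    using ne1[of u] u(2) by (simp add: B_def)
  then show ?thesis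
    using G[OF u(2)] u(1) by (simp add: G_def pseudo_dist_def norm_divide)
qed

lemma pseudo_dist_le_norm_diff:
  assumes "Im z > 0" "Im w > 0" "pseudo_dist z w \<le> k"
  shows "norm (z - w) \<le> k * norm (z - cnj w)"
proof -
  have "norm (z - cnj w) > 0"
    using norm_diff_less_norm_diff_cnj[OF assms(1,2)] norm_ge_zero le_less_trans by blast
  then show ?thesis using assms(3) by (simp add: pseudo_dist_def field_simps)
qed

text \<open>Conjugation preserves the modulus, so the denominator of \<open>pseudo_dist\<close> is
  at most \<open>norm z + norm w\<close>; the term \<open>k * norm z\<close> is absorbed on the
  left.\<close>

lemma norm_le_of_pseudo_dist:
  assumes "Im z > 0" "Im w > 0" "pseudo_dist z w \<le> k" "k < 1"
  shows "norm z \<le> (1 + k) / (1 - k) * norm w"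
proof -
  have "0 \<le> k"
    using pseudo_dist_bounds(1)[OF assms(1,2)] assms(3) by linarith
  have "norm (z - cnj w) \<le> norm z + norm w"
    using norm_triangle_ineq4[of z "cnj w"] by simp
  then have "norm (z - w) \<le> k * (norm z + norm w)"
    using pseudo_dist_le_norm_diff[OF assms(1-3)] \<open>0 \<le> k\<close>
    by (meson mult_left_mono order_trans)
  moreover have "norm z - norm w \<le> norm (z - w)"
    by (rule norm_triangle_ineq2)
  ultimately have "(1 - k) * norm z \<le> (1 + k) * norm w"
    by (simp add: algebra_simps)
  then show ?thesis using assms(4) by (simp add: field_simps)
qed

text \<open>Here the denominator is bounded by \<open>norm (z - w) + 2 * Im w\<close>, and
  \<open>k * norm (z - w)\<close> is absorbed.\<close>

lemma norm_diff_le_Im_of_pseudo_dist: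
  assumes "Im z > 0" "Im w > 0" "pseudo_dist z w \<le> k" "k < 1"
  shows "norm (z - w) \<le> 2 * k / (1 - k) * Im w"
proof -
  have "0 \<le> k"
    using pseudo_dist_bounds(1)[OF assms(1,2)] assms(3) by linarith
  have "w - cnj w = of_real (2 * Im w) * \<i>" by (simp add: complex_eq_iff)
  then have "norm (w - cnj w) = 2 * Im w" using assms(2) by (simp add: norm_mult)
  then have "norm (z - cnj w) \<le> norm (z - w) + 2 * Im w"
    using norm_triangle_ineq[of "z - w" "w - cnj w"] by simp
  then have "norm (z - w) \<le> k * (norm (z - w) + 2 * Im w)"
    using pseudo_dist_le_norm_diff[OF assms(1-3)] \<open>0 \<le> k\<close>
    by (meson mult_left_mono order_trans)
  then show ?thesis using assms(4) by (simp add: field_simps)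
qed

text \<open>The previous bound makes \<open>a n - b n\<close> small relative to
  \<open>Im (b n)\<close>, hence relative to \<open>norm (b n)\<close>.\<close>

lemma tendsto_divide_one_of_pseudo_dist:
  assumes a: "\<And>n. Im (a n) > 0" and b: "\<And>n. Im (b n) > 0"
    and lim: "(\<lambda>n. pseudo_dist (a n) (b n)) \<longlonglongrightarrow> 0"
  shows "(\<lambda>n. a n / b n) \<longlonglongrightarrow> 1"
proof -
  let ?d = "\<lambda>n. pseudo_dist (a n) (b n)"
  have "(\<lambda>n. 2 * ?d n / (1 - ?d n)) \<longlonglongrightarrow> 2 * 0 / (1 - 0)"
    by (intro tendsto_intros lim) simp
  then have "(\<lambda>n. 2 * ?d n / (1 - ?d n)) \<longlonglongrightarrow> 0" by simp
  moreover have "norm (a n / b n - 1) \<le> 2 * ?d n / (1 - ?d n)" for n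
  proof -
    have d: "0 \<le> ?d n" "?d n < 1" using pseudo_dist_bounds a b by blast+
    have "b n \<noteq> 0" using b[of n] by auto
    have "norm (a n - b n) \<le> 2 * ?d n / (1 - ?d n) * Im (b n)"
      using norm_diff_le_Im_of_pseudo_dist[OF a b order_refl d(2)] .
    also have "\<dots> \<le> 2 * ?d n / (1 - ?d n) * norm (b n)"
      using d abs_Im_le_cmod[of "b n"] by (intro mult_left_mono) auto
    finally have "norm (a n - b n) / norm (b n) \<le> 2 * ?d n / (1 - ?d n)"
      using \<open>b n \<noteq> 0\<close> by (simp add: pos_divide_le_eq)
    moreover have "a n / b n - 1 = (a n - b n) / b n"
      using \<open>b n \<noteq> 0\<close> by (simp add: field_simps)
    ultimately show ?thesis by (simp add: norm_divide)
  qed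
  ultimately have "(\<lambda>n. a n / b n - 1) \<longlonglongrightarrow> 0"
    by - (rule Lim_null_comparison[of "\<lambda>n. a n / b n - 1"], auto)
  then show ?thesis by (rule LIM_zero_cancel)
qed

section \<open>Iterates, displacements and the zero-step condition\<close>

text \<open>Strict growth of the imaginary part says that the displacement also maps the half-plane
  into itself, so Schwarz--Pick applies to it.\<close>

locale half_plane_displacement =
  fixes \<phi> :: "complex \<Rightarrow> complex"
  assumes hol: "\<phi> holomorphic_on upper_half_plane"
    and Im_less: "\<And>z. Im z > 0 \<Longrightarrow> Im z < Im (\<phi> z)"
begin

lemma Im_iterate: "Im z > 0 \<Longrightarrow> Im ((\<phi> ^^ n) z) > 0"
  by (induction n) (use Im_less in fastforce)+

lemma holomorphic_iterate: "(\<phi> ^^ n) holomorphic_on upper_half_plane"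
proof (induction n)
  case 0
  show ?case by (simp add: id_def)
next
  case (Suc n)
  show ?case
    unfolding funpow.simps
    by (rule holomorphic_on_compose_gen[OF Suc hol])
      (auto simp: upper_half_plane_def intro: Im_iterate)
qed

text \<open>At the base point this is the denominator of \<open>bp_affine\<close>.\<close>

definition step :: "nat \<Rightarrow> complex \<Rightarrow> complex" where
  "step n z = (\<phi> ^^ Suc n) z - (\<phi> ^^ n) z"

lemma Im_step: "Im z > 0 \<Longrightarrow> Im (step n z) > 0"
  using Im_less[OF Im_iterate] by (simp add: step_def)

lemma step_nonzero: "Im z > 0 \<Longrightarrow> step n z \<noteq> 0"
  using Im_step[of z n] by auto

lemma holomorphic_step: "step n holomorphic_on upper_half_plane"
  using holomorphic_on_diff[OF holomorphic_iterate[of "Suc n"] holomorphic_iterate[of n]]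
  by (simp add: step_def[abs_def])

lemma pseudo_dist_le_step_ratio:
  assumes "Im z > 0"
  shows "pseudo_dist ((\<phi> ^^ Suc n) z) ((\<phi> ^^ n) z) \<le> norm (step n z) / Im ((\<phi> ^^ n) z)"
proof -
  have "Im ((\<phi> ^^ n) z) \<le> Im ((\<phi> ^^ Suc n) z - cnj ((\<phi> ^^ n) z))"
    using Im_iterate[OF assms, of "Suc n"] by simp
  also have "\<dots> \<le> norm ((\<phi> ^^ Suc n) z - cnj ((\<phi> ^^ n) z))"
    using abs_Im_le_cmod abs_le_D1 by blast
  finally show ?thesis
    unfolding pseudo_dist_def step_def
    using Im_iterate[OF assms, of n] by (intro divide_left_mono mult_pos_pos) auto
qed

text \<open>In this form of the zero-step condition, numerator and denominator can be compared
  separately at different starting points.\<close>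

lemma zero_step_ratio:
  assumes z: "Im z > 0"
    and lim: "(\<lambda>n. pseudo_dist ((\<phi> ^^ n) z) ((\<phi> ^^ Suc n) z)) \<longlonglongrightarrow> 0"
  shows "(\<lambda>n. norm (step n z) / Im ((\<phi> ^^ n) z)) \<longlonglongrightarrow> 0"
proof -
  define d where "d = (\<lambda>n. pseudo_dist ((\<phi> ^^ n) z) ((\<phi> ^^ Suc n) z))"
  \<comment> \<open>The bound by an imaginary part uses the second argument, which has to be the
    n-th iterate.\<close>
  have sym: "pseudo_dist ((\<phi> ^^ Suc n) z) ((\<phi> ^^ n) z) = d n" for n
  proof -
    have "norm (v - cnj w) = norm (w - cnj v)" for v w
      by (simp add: cmod_def power2_eq_square algebra_simps)
    from this[of "(\<phi> ^^ Suc n) z" "(\<phi> ^^ n) z"] show ?thesis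
      by (simp only: d_def pseudo_dist_def norm_minus_commute[of "(\<phi> ^^ Suc n) z" "(\<phi> ^^ n) z"])
  qed
  have "(\<lambda>n. 2 * d n / (1 - d n)) \<longlonglongrightarrow> 2 * 0 / (1 - 0)"
    using lim by (intro tendsto_intros) (simp_all add: d_def)
  then have "(\<lambda>n. 2 * d n / (1 - d n)) \<longlonglongrightarrow> 0" by simp
  moreover have "norm (step n z) / Im ((\<phi> ^^ n) z) \<le> 2 * d n / (1 - d n)" for n
  proof -
    have "d n < 1" unfolding d_def by (intro pseudo_dist_bounds Im_iterate z)
    then have "norm (step n z) \<le> 2 * d n / (1 - d n) * Im ((\<phi> ^^ n) z)"
      unfolding step_def
      by (intro norm_diff_le_Im_of_pseudo_dist Im_iterate z) (simp_all only: sym)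
    then show ?thesis
      using Im_iterate[OF z, of n] by (simp add: pos_divide_le_eq)
  qed
  ultimately show ?thesis
    by - (rule Lim_null_comparison[of _ "\<lambda>n. 2 * d n / (1 - d n)"],
      auto simp: less_imp_le Im_iterate[OF z])
qed

text \<open>Schwarz--Pick, applied to \<^term>\<open>step n\<close> and to \<^term>\<open>\<phi> ^^ n\<close>, bounds the change of
  numerator and denominator between base points by factors independent of \<open>n\<close>.\<close>

lemma zero_step_ratio_transfer:
  assumes z: "Im z > 0" and w: "Im w > 0"
    and lim: "(\<lambda>n. norm (step n z) / Im ((\<phi> ^^ n) z)) \<longlonglongrightarrow> 0"
  shows "(\<lambda>n. norm (step n w) / Im ((\<phi> ^^ n) w)) \<longlonglongrightarrow> 0"
proof -
  \<comment> \<open>Both orders of the arguments are covered, so symmetry of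
    \<open>pseudo_dist\<close> is not invoked.\<close>
  define k where "k = max (pseudo_dist w z) (pseudo_dist z w)"
  have k: "k < 1" "0 \<le> k" "pseudo_dist w z \<le> k" "pseudo_dist z w \<le> k"
    using pseudo_dist_bounds z w by (auto simp: k_def le_max_iff_disj)
  define C where "C = (1 + k) / (1 - k)"
  have C: "C > 0" using k by (simp add: C_def)
  have "norm (step n w) / Im ((\<phi> ^^ n) w) \<le> C\<^sup>2 * (norm (step n z) / Im ((\<phi> ^^ n) z))" for n
  proof -
    have "pseudo_dist (step n w) (step n z) \<le> k"
      using schwarz_pick[OF holomorphic_step Im_step w z] k(3) by (rule order_trans)
    then have num: "norm (step n w) \<le> C * norm (step n z)"
      unfolding C_def using z w k(1) by (intro norm_le_of_pseudo_dist Im_step)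
    \<comment> \<open>The roles of \<open>z\<close> and \<open>w\<close> are swapped, since the
      denominator at \<open>w\<close> must be bounded from below.\<close>
    have "pseudo_dist ((\<phi> ^^ n) z) ((\<phi> ^^ n) w) \<le> k"
      using schwarz_pick[OF holomorphic_iterate Im_iterate z w] k(4) by (rule order_trans)
    then have "norm ((\<phi> ^^ n) z - (\<phi> ^^ n) w) \<le> 2 * k / (1 - k) * Im ((\<phi> ^^ n) w)"
      using z w k(1) by (intro norm_diff_le_Im_of_pseudo_dist Im_iterate)
    moreover have "Im ((\<phi> ^^ n) z) - Im ((\<phi> ^^ n) w) \<le> norm ((\<phi> ^^ n) z - (\<phi> ^^ n) w)"
      using abs_Im_le_cmod[of "(\<phi> ^^ n) z - (\<phi> ^^ n) w"] by simp
    moreover have "C = 2 * k / (1 - k) + 1" using k(1) by (simp add: C_def field_simps)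
    ultimately have den: "Im ((\<phi> ^^ n) z) \<le> C * Im ((\<phi> ^^ n) w)"
      by (simp add: distrib_right)
    have pos: "Im ((\<phi> ^^ n) z) > 0" "Im ((\<phi> ^^ n) w) > 0" using Im_iterate z w by auto
    have "norm (step n w) * Im ((\<phi> ^^ n) z) \<le> (C * norm (step n z)) * (C * Im ((\<phi> ^^ n) w))"
      using num den pos C by (intro mult_mono) auto
    then show ?thesis using pos by (simp add: field_simps power2_eq_square)
  qed
  moreover have "(\<lambda>n. C\<^sup>2 * (norm (step n z) / Im ((\<phi> ^^ n) z))) \<longlonglongrightarrow> 0"
    using tendsto_mult_left[OF lim, of "C\<^sup>2"] by simp
  ultimately show ?thesis
    by - (rule Lim_null_comparison[of _ "\<lambda>n. C\<^sup>2 * (norm (step n z) / Im ((\<phi> ^^ n) z))"],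
      auto simp: less_imp_le Im_iterate[OF w])
qed

lemma step_quotient_tendsto_one:
  assumes z: "Im z > 0"
    and lim: "(\<lambda>n. norm (step n z) / Im ((\<phi> ^^ n) z)) \<longlonglongrightarrow> 0"
  shows "(\<lambda>n. step (Suc n) z / step n z) \<longlonglongrightarrow> 1"
proof (rule tendsto_divide_one_of_pseudo_dist)
  \<comment> \<open>All displacements are values of the single map \<open>step 0\<close>, so
    Schwarz--Pick can compare its values at consecutive iterates.\<close>
  have iter: "step n z = step 0 ((\<phi> ^^ n) z)" for n
    by (simp add: step_def)
  have "pseudo_dist (step (Suc n) z) (step n z) \<le> norm (step n z) / Im ((\<phi> ^^ n) z)" for n
    using schwarz_pick[OF holomorphic_step[of 0] Im_step Im_iterate[OF z, of "Suc n"]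
        Im_iterate[OF z, of n]] pseudo_dist_le_step_ratio[OF z, of n]
    unfolding iter[symmetric] by linarith
  then show "(\<lambda>n. pseudo_dist (step (Suc n) z) (step n z)) \<longlonglongrightarrow> 0"
    using pseudo_dist_bounds(1)[OF Im_step[OF z] Im_step[OF z]]
    by - (rule Lim_null_comparison[OF _ lim], auto)
qed (use Im_step[OF z] in auto)

section \<open>The functional equation of the semiconjugation\<close>

lemma baker_pommerenke_tendsto:
  assumes "is_baker_pommerenke \<phi> z0 h" and "Im z > 0"
  shows "(\<lambda>n. ((\<phi> ^^ n) z - (\<phi> ^^ n) z0) / step n z0) \<longlonglongrightarrow> h z"
proof -
  have "(\<lambda>n. bp_affine \<phi> z0 n ((\<phi> ^^ n) z)) \<longlonglongrightarrow> h z"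
    using assms(1)[unfolded is_baker_pommerenke_def, rule_format, of "{z}"] assms(2)
    by (simp add: upper_half_plane_def)
  then show ?thesis by (simp add: bp_affine_def step_def)
qed

text \<open>The limit at \<open>z\<close> is taken with index \<open>Suc n\<close>, and the quotient
  of consecutive factors restores the normalisation by \<open>step n z0\<close>.\<close>

lemma baker_pommerenke_shift:
  assumes bp: "is_baker_pommerenke \<phi> z0 h" and z0: "Im z0 > 0" and z: "Im z > 0"
    and lim: "(\<lambda>n. step (Suc n) z0 / step n z0) \<longlonglongrightarrow> 1"
  shows "h (\<phi> z) = h z + 1"
proof -
  have "(\<lambda>n. ((\<phi> ^^ Suc n) z - (\<phi> ^^ Suc n) z0) / step (Suc n) z0 *
      (step (Suc n) z0 / step n z0) + 1) \<longlonglongrightarrow> h z * 1 + 1"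
    by (intro tendsto_intros lim LIMSEQ_Suc[OF baker_pommerenke_tendsto[OF bp z]])
  \<comment> \<open>The added 1 is \<open>step n z0 / step n z0\<close>; it moves the subtracted
    point back from the iterate \<open>Suc n\<close> of \<open>z0\<close> to the iterate
    \<open>n\<close>.\<close>
  moreover have "((\<phi> ^^ Suc n) z - (\<phi> ^^ Suc n) z0) / step (Suc n) z0 *
      (step (Suc n) z0 / step n z0) + 1 = ((\<phi> ^^ n) (\<phi> z) - (\<phi> ^^ n) z0) / step n z0" for n
  proof -
    have "((\<phi> ^^ Suc n) z - (\<phi> ^^ Suc n) z0) / step (Suc n) z0 * (step (Suc n) z0 / step n z0)
        = ((\<phi> ^^ Suc n) z - (\<phi> ^^ Suc n) z0) / step n z0"
      using step_nonzero[OF z0] by simp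
    also have "\<dots> + 1 = ((\<phi> ^^ Suc n) z - (\<phi> ^^ Suc n) z0 + step n z0) / step n z0"
      using step_nonzero[OF z0, of n] by (simp add: add_divide_distrib)
    also have "\<dots> = ((\<phi> ^^ n) (\<phi> z) - (\<phi> ^^ n) z0) / step n z0"
      by (simp add: step_def funpow_swap1)
    finally show ?thesis .
  qed
  ultimately have "(\<lambda>n. ((\<phi> ^^ n) (\<phi> z) - (\<phi> ^^ n) z0) / step n z0) \<longlonglongrightarrow> h z + 1"
    by simp
  moreover have "Im (\<phi> z) > 0" using Im_less[OF z] z by simp
  ultimately show ?thesis
    using LIMSEQ_unique baker_pommerenke_tendsto[OF bp] by blast
qed

end

section \<open>Change of base point\<close>

theorem corollary7p7:
  fixes \<phi> h h' :: "complex \<Rightarrow> complex" and z0 z0' :: complex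
  assumes "parabolic_zero_step \<phi>"
    and "z0 \<in> upper_half_plane" and "z0' \<in> upper_half_plane"
    and "is_baker_pommerenke \<phi> z0 h"
    and "is_baker_pommerenke \<phi> z0' h'"
  shows "\<forall>z\<in>upper_half_plane. h' z = h z - h z0'"
proof
  fix z assume "z \<in> upper_half_plane"
  then have z: "Im z > 0" and z0: "Im z0 > 0" and z0': "Im z0' > 0"
    using assms(2,3) by (auto simp: upper_half_plane_def)
  interpret half_plane_displacement \<phi>
  proof
    show "\<phi> holomorphic_on upper_half_plane"
      using assms(1) by (simp add: parabolic_zero_step_def)
    show "Im w < Im (\<phi> w)" if "Im w > 0" for w
      using assms(1) that unfolding parabolic_zero_step_def upper_half_plane_def by force
  qed
  \<comment> \<open>This point may differ from \<open>z0\<close>;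
    \<open>zero_step_ratio_transfer\<close> carries the condition over.\<close>
  obtain w where w: "Im w > 0"
    and hyp: "(\<lambda>n. hyp_dist ((\<phi> ^^ n) w) ((\<phi> ^^ Suc n) w)) \<longlonglongrightarrow> 0"
    using assms(1) unfolding parabolic_zero_step_def upper_half_plane_def by blast
  have "(\<lambda>n. tanh (hyp_dist ((\<phi> ^^ n) w) ((\<phi> ^^ Suc n) w) / 2)) \<longlonglongrightarrow> tanh (0 / 2)"
    using hyp by (intro tendsto_intros) auto
  then have "(\<lambda>n. pseudo_dist ((\<phi> ^^ n) w) ((\<phi> ^^ Suc n) w)) \<longlonglongrightarrow> 0"
    by (simp only: tanh_half_hyp_dist[OF Im_iterate[OF w] Im_iterate[OF w]]) simp
  then have "(\<lambda>n. step (Suc n) z0 / step n z0) \<longlonglongrightarrow> 1"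
    by (intro step_quotient_tendsto_one zero_step_ratio_transfer[OF w z0] zero_step_ratio w z0)
  then have shift: "h (\<phi> z0') - h z0' = 1"
    using baker_pommerenke_shift[OF assms(4) z0 z0'] by simp
  \<comment> \<open>Subtracting the limits at \<open>v\<close> and \<open>z0'\<close> cancels the
    iterates of \<open>z0\<close>. This is used for \<open>\<phi> z0'\<close> and for
    \<open>z\<close>.\<close>
  have diff: "(\<lambda>n. ((\<phi> ^^ n) v - (\<phi> ^^ n) z0') / step n z0) \<longlonglongrightarrow> h v - h z0'" if "Im v > 0" for v
    using tendsto_diff[OF baker_pommerenke_tendsto[OF assms(4) that]
        baker_pommerenke_tendsto[OF assms(4) z0']]
    by (simp add: diff_divide_distrib)
  have "Im (\<phi> z0') > 0" using Im_less[OF z0'] z0' by simp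
  \<comment> \<open>For \<open>v = \<phi> z0'\<close> the numerator is the displacement
    \<open>step n z0'\<close>.\<close>
  from diff[OF this] have "(\<lambda>n. step n z0' / step n z0) \<longlonglongrightarrow> 1"
    unfolding shift by (simp add: step_def funpow_swap1)
  \<comment> \<open>The factor \<open>step n z0\<close> cancels, which leaves the sequence defining
    \<open>h' z\<close>.\<close>
  from tendsto_divide[OF diff[OF z] this]
  have "(\<lambda>n. ((\<phi> ^^ n) z - (\<phi> ^^ n) z0') / step n z0') \<longlonglongrightarrow> h z - h z0'"
    using step_nonzero[OF z0] by simp
  then show "h' z = h z - h z0'"
    using LIMSEQ_unique baker_pommerenke_tendsto[OF assms(5) z] by blast
qed

end
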